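(* For every integer $n\ge 9$, there exists an $n$-element non-planar join-semilattice with exactly $127\cdot 2^{n-8}-1$ subsemilattices.
   Context: A (join-)semilattice $(L;\vee)$ is a nonempty set $L$ with a commutative, associative, idempotent binary operation $\vee$; it is regarded as a poset via $x\le y \iff x\vee y=y$, so that $x\vee y$ is the least upper bound of $x$ and $y$. A subsemilattice of $L$ is a nonempty subset of $L$ closed under $\vee$. A Hasse diagram of a finite poset represents its elements by distinct points of the plane and each covering pair $x\prec y$ by a straight line segment from $x$ up to $y$, where $y$ has a strictly larger vertical coordinate than $x$ (and no segment passes through a point representing an element other than its endpoints). A finite semilattice is planar if its underlying poset has a Hasse diagram that is also a planar representation of a graph, i.e., one in which no two segments meet except possibly at common endpoints; otherwise it is non-planar. *)

theory Defs
  imports "HOL-Analysis.Analysis"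
begin

locale join_semilattice_on =
  fixes L :: "'a set" and join :: "'a \<Rightarrow> 'a \<Rightarrow> 'a"
  assumes nonempty: "L \<noteq> {}"
    and closed: "x \<in> L \<Longrightarrow> y \<in> L \<Longrightarrow> join x y \<in> L"
    and commute: "x \<in> L \<Longrightarrow> y \<in> L \<Longrightarrow> join x y = join y x"
    and assoc: "x \<in> L \<Longrightarrow> y \<in> L \<Longrightarrow> z \<in> L \<Longrightarrow> join (join x y) z = join x (join y z)"
    and idem: "x \<in> L \<Longrightarrow> join x x = x"

definition join_le :: "('a \<Rightarrow> 'a \<Rightarrow> 'a) \<Rightarrow> 'a \<Rightarrow> 'a \<Rightarrow> bool" where
  "join_le join x y \<longleftrightarrow> join x y = y"

definition subsemilattices :: "'a set \<Rightarrow> ('a \<Rightarrow> 'a \<Rightarrow> 'a) \<Rightarrow> 'a set set" where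
  "subsemilattices L join =
     {S. S \<noteq> {} \<and> S \<subseteq> L \<and> (\<forall>x\<in>S. \<forall>y\<in>S. join x y \<in> S)}"

definition covered_by :: "'a set \<Rightarrow> ('a \<Rightarrow> 'a \<Rightarrow> bool) \<Rightarrow> 'a \<Rightarrow> 'a \<Rightarrow> bool" where
  "covered_by A le x y \<longleftrightarrow>
     x \<in> A \<and> y \<in> A \<and> le x y \<and> x \<noteq> y \<and>
     (\<forall>z\<in>A. le x z \<and> le z y \<longrightarrow> z = x \<or> z = y)"

text \<open>The second coordinate of a point of \<^typ>\<open>real \<times> real\<close> is the vertical one.\<close>

definition hasse_diagram ::
    "'a set \<Rightarrow> ('a \<Rightarrow> 'a \<Rightarrow> bool) \<Rightarrow> ('a \<Rightarrow> real \<times> real) \<Rightarrow> bool" where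
  "hasse_diagram A le pos \<longleftrightarrow>
     inj_on pos A \<and>
     (\<forall>x y. covered_by A le x y \<longrightarrow>
        snd (pos x) < snd (pos y) \<and>
        (\<forall>z\<in>A. pos z \<in> closed_segment (pos x) (pos y) \<longrightarrow> z = x \<or> z = y))"

definition planar_hasse_diagram ::
    "'a set \<Rightarrow> ('a \<Rightarrow> 'a \<Rightarrow> bool) \<Rightarrow> ('a \<Rightarrow> real \<times> real) \<Rightarrow> bool" where
  "planar_hasse_diagram A le pos \<longleftrightarrow>
     hasse_diagram A le pos \<and>
     (\<forall>x y u v. covered_by A le x y \<and> covered_by A le u v \<and> (x, y) \<noteq> (u, v) \<longrightarrow>
        closed_segment (pos x) (pos y) \<inter> closed_segment (pos u) (pos v)
          \<subseteq> {pos x, pos y} \<inter> {pos u, pos v})"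

definition planar_poset :: "'a set \<Rightarrow> ('a \<Rightarrow> 'a \<Rightarrow> bool) \<Rightarrow> bool" where
  "planar_poset A le \<longleftrightarrow> (\<exists>pos. planar_hasse_diagram A le pos)"

definition planar_semilattice :: "'a set \<Rightarrow> ('a \<Rightarrow> 'a \<Rightarrow> 'a) \<Rightarrow> bool" where
  "planar_semilattice L join \<longleftrightarrow> planar_poset L (join_le join)"

end

theory Submission
  imports Defs
begin

text \<open>
  The witness is a chain \<open>0 < 1 < 2 < 3 < 4 < 8 < 9 < \<dots> < n - 1\<close>, the spine, together with
  three ears: the element \<open>5\<close> placed between \<open>1\<close> and \<open>4\<close>, the element \<open>6\<close> between \<open>2\<close> and
  \<open>8\<close>, and the element \<open>7\<close> between \<open>0\<close> and \<open>3\<close>.  Two elements that are not comparable have their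
  join on the spine, namely the higher of the two upper ends.

  Why it is not planar: every covering segment goes strictly upwards, so the spine and each of the
  three ears is drawn as the graph of a continuous function of the height.  In a planar diagram
  these curves meet only at the ends of the ears, hence each ear stays on one side of the spine.
  Two ears on the same side of the spine whose ranges of heights overlap without being nested must
  cross: the one that starts later starts inside the region cut off by the other and ends outside
  it.  The ears 5, 6 and 7 overlap pairwise in this way, and there are only two sides.  All of this
  needs no more than the intermediate value theorem (\<open>same_side\<close>, \<open>three_ears_cross\<close>); the
  translation from diagrams to functions is \<open>ex_curve_along\<close> and
  \<open>curves_meet_at_common_vertex\<close>.

  Why the number is right: a set \<open>S\<close> is closed under joins exactly when it satisfies the three
  implications of \<open>ear_closed\<close>.  There are \<open>2 ^ (n - 3)\<close> sets of spine elements.  Among them the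
  fraction compatible with a given set of ears is \<open>1\<close> for no ear, \<open>5/8\<close> for each single ear,
  \<open>5/16\<close> for each pair of ears and \<open>5/32\<close> for all three, and
  \<open>1 + 15/8 + 15/16 + 5/32 = 127/32\<close>.  So there are \<open>127 * 2 ^ (n - 8)\<close> closed sets, one of which
  is empty.
\<close>

section \<open>Semilattices from intervals in a chain\<close>

text \<open>
  Each element \<open>x\<close> carries an interval from \<open>lo x\<close> to \<open>hi x\<close> whose ends are spine elements; a
  spine element is the common end of its own one-point interval.  The order behind the operation
  is the interval order: \<open>x\<close> lies below a different element \<open>y\<close> iff the interval of \<open>x\<close> ends
  before that of \<open>y\<close> begins.
\<close>
definition interval_join :: "('a \<Rightarrow> 'a) \<Rightarrow> ('a \<Rightarrow> 'a) \<Rightarrow> 'a \<Rightarrow> 'a \<Rightarrow> 'a::linorder" where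
  "interval_join lo hi x y =
     (if x = y \<or> hi x \<le> lo y then y else if hi y \<le> lo x then x else max (hi x) (hi y))"

locale interval_labels =
  fixes lo hi :: "'a::linorder \<Rightarrow> 'a"
  assumes lo_le_hi: "lo x \<le> hi x"
    and lo_hi: "lo (hi x) = hi x"
    and hi_hi: "hi (hi x) = hi x"
    and degenerate: "lo x = hi x \<Longrightarrow> hi x = x"
begin

abbreviation le :: "'a \<Rightarrow> 'a \<Rightarrow> bool" where
  "le x y \<equiv> x = y \<or> hi x \<le> lo y"

lemma le_trans: "le x y \<Longrightarrow> le y z \<Longrightarrow> le x z"
  using lo_le_hi[of y] by auto

text \<open>
  Two elements below each other have the same one-point interval, which determines the element.
\<close>
lemma le_antisym: "le x y \<Longrightarrow> le y x \<Longrightarrow> x = y"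
proof -
  assume xy: "le x y" "le y x"
  have "x = y" if h: "hi x \<le> lo y" "hi y \<le> lo x"
  proof -
    have "hi x = lo x" "hi y = lo y" "hi x = hi y"
      using h lo_le_hi[of x] lo_le_hi[of y] by auto
    then show ?thesis using degenerate[of x] degenerate[of y] by auto
  qed
  then show ?thesis using xy by auto
qed

lemma max_hi_fixed:
  "lo (max (hi x) (hi y)) = max (hi x) (hi y)" "hi (max (hi x) (hi y)) = max (hi x) (hi y)"
  by (auto simp: max_def lo_hi hi_hi)

lemma join_upper: "le x (interval_join lo hi x y)" "le y (interval_join lo hi x y)"
  by (auto simp: interval_join_def max_hi_fixed)

lemma join_least: "le x z \<Longrightarrow> le y z \<Longrightarrow> le (interval_join lo hi x y) z"
  by (auto simp: interval_join_def max_hi_fixed)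

lemma join_le_iff: "join_le (interval_join lo hi) x y \<longleftrightarrow> le x y"
  unfolding join_le_def
  by (metis interval_join_def join_upper(1))

lemma join_commute: "interval_join lo hi x y = interval_join lo hi y x"
  by (intro le_antisym join_least join_upper)

text \<open>
  The operation computes least upper bounds of a partial order, and this gives associativity
  without comparing the cases of the definition.
\<close>
lemma semilattice:
  assumes "L \<noteq> {}" and hi_closed: "\<And>x. x \<in> L \<Longrightarrow> hi x \<in> L"
  shows "join_semilattice_on L (interval_join lo hi)"
proof
  fix x y z
  let ?j = "interval_join lo hi"
  show "?j x y = ?j y x"
    by (rule join_commute)
  show "?j (?j x y) z = ?j x (?j y z)"
  proof (rule le_antisym)
    show "le (?j (?j x y) z) (?j x (?j y z))"
      by (intro join_least; metis join_upper le_trans)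
    show "le (?j x (?j y z)) (?j (?j x y) z)"
      by (intro join_least; metis join_upper le_trans)
  qed
  show "?j x x = x" by (simp add: interval_join_def)
  show "?j x y \<in> L" if "x \<in> L" "y \<in> L"
    using that hi_closed by (auto simp: interval_join_def max_def)
qed (use assms in auto)

end

section \<open>Ascending chains of segments as curves\<close>

abbreviation chain_edges :: "'a list \<Rightarrow> ('a \<times> 'a) set" where
  "chain_edges xs \<equiv> set (zip xs (tl xs))"

text \<open>
  The curve is given as a function from heights to horizontal coordinates, so that the drawing
  passes through the points \<open>(f t, t)\<close>.  Continuity is required on the whole line only for
  convenience; outside the range of heights of the chain the values are arbitrary.
\<close>
definition curve_along :: "('a \<Rightarrow> real \<times> real) \<Rightarrow> 'a list \<Rightarrow> (real \<Rightarrow> real) \<Rightarrow> bool" where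
  "curve_along pos xs f \<longleftrightarrow>
     continuous_on UNIV f \<and> (\<forall>v\<in>set xs. f (snd (pos v)) = fst (pos v)) \<and>
     (\<forall>t\<in>{snd (pos (hd xs))..snd (pos (last xs))}.
        \<exists>(a, b)\<in>chain_edges xs. (f t, t) \<in> closed_segment (pos a) (pos b))"

lemma segment_curve:
  fixes p q :: "real \<times> real"
  assumes "snd p < snd q"
  obtains f :: "real \<Rightarrow> real" where "continuous_on UNIV f" "f (snd p) = fst p" "f (snd q) = fst q"
    "\<And>t. t \<in> {snd p..snd q} \<Longrightarrow> (f t, t) \<in> closed_segment p q"
proof -
  define u where "u t = (t - snd p) / (snd q - snd p)" for t
  define f where "f t = (1 - u t) * fst p + u t * fst q" for t
  have "continuous_on UNIV f" unfolding f_def u_def using assms by (intro continuous_intros) auto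
  moreover have "f (snd p) = fst p" "f (snd q) = fst q"
    using assms by (auto simp: f_def u_def)
  moreover have "(f t, t) \<in> closed_segment p q" if "t \<in> {snd p..snd q}" for t
  proof -
    have "0 \<le> u t" "u t \<le> 1" using that assms by (auto simp: u_def)
    moreover have "u t * (snd q - snd p) = t - snd p" using assms by (simp add: u_def)
    then have "(f t, t) = (1 - u t) *\<^sub>R p + u t *\<^sub>R q"
      by (simp add: prod_eq_iff f_def algebra_simps)
    ultimately show ?thesis unfolding closed_segment_def by blast
  qed
  ultimately show thesis using that by blast
qed

lemma heights_above_head:
  assumes "\<And>a b. (a, b) \<in> chain_edges (x # xs) \<Longrightarrow> h a < (h b :: real)" and "v \<in> set (x # xs)"
  shows "h x \<le> h v"
  using assms
proof (induction xs arbitrary: x)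
  case (Cons y ys)
  have "h x < h y" using Cons.prems(1) by simp
  moreover have "h y \<le> h v" if "v \<in> set (y # ys)"
    using that Cons.prems(1) by (intro Cons.IH) auto
  ultimately show ?case using Cons.prems(2) by auto
qed simp

lemma ex_curve_along:
  assumes "\<And>a b. (a, b) \<in> chain_edges (x # y # zs) \<Longrightarrow> snd (pos a) < snd (pos b)"
  shows "\<exists>f. curve_along pos (x # y # zs) f"
  using assms
proof (induction zs arbitrary: x y)
  case Nil
  then have "snd (pos x) < snd (pos y)" by simp
  then obtain f where "continuous_on UNIV f" "f (snd (pos x)) = fst (pos x)" "f (snd (pos y)) = fst (pos y)"
    "\<And>t. t \<in> {snd (pos x)..snd (pos y)} \<Longrightarrow> (f t, t) \<in> closed_segment (pos x) (pos y)"
    using segment_curve by blast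
  then show ?case by (intro exI[of _ f]) (simp add: curve_along_def)
next
  case (Cons z zs)
  let ?y = "snd (pos y)"
  have xy: "snd (pos x) < ?y" using Cons.prems by simp
  have "\<exists>f. curve_along pos (y # z # zs) f"
    using Cons.prems by (intro Cons.IH) auto
  then obtain f where "curve_along pos (y # z # zs) f" by blast
  then have f: "continuous_on UNIV f"
      "\<And>v. v \<in> set (y # z # zs) \<Longrightarrow> f (snd (pos v)) = fst (pos v)"
      "\<And>t. t \<in> {?y..snd (pos (last (z # zs)))} \<Longrightarrow>
         \<exists>(a, b)\<in>chain_edges (y # z # zs). (f t, t) \<in> closed_segment (pos a) (pos b)"
    by (auto simp: curve_along_def)
  have above: "?y \<le> snd (pos v)" if "v \<in> set (y # z # zs)" for v
    using heights_above_head[of y "z # zs" "\<lambda>v. snd (pos v)" v] that Cons.prems by simp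
  obtain g where g: "continuous_on UNIV g" "g (snd (pos x)) = fst (pos x)" "g ?y = fst (pos y)"
    "\<And>t. t \<in> {snd (pos x)..?y} \<Longrightarrow> (g t, t) \<in> closed_segment (pos x) (pos y)"
    using segment_curve[OF xy] by blast
  define h where "h t = (if t \<le> ?y then g t else f t)" for t
  have gf: "g ?y = f ?y" using g f(2)[of y] by simp
  have "continuous_on ({..?y} \<union> {?y..}) h"
    unfolding h_def
    by (rule continuous_on_If)
       (use gf in \<open>auto intro: continuous_on_subset[OF g(1)] continuous_on_subset[OF f(1)]\<close>)
  moreover have "{..?y} \<union> {?y..} = UNIV" by auto
  ultimately have "continuous_on UNIV h" by simp
  moreover have "h (snd (pos v)) = fst (pos v)" if "v \<in> set (x # y # z # zs)" for v
  proof (cases "v \<in> set (y # z # zs)")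
    case True
    then show ?thesis using f(2)[OF True] above[OF True] gf by (auto simp: h_def dest: antisym)
  next
    case False
    then have "v = x" using that by simp
    then show ?thesis using xy g by (simp add: h_def)
  qed
  moreover have "\<exists>(a, b)\<in>chain_edges (x # y # z # zs). (h t, t) \<in> closed_segment (pos a) (pos b)"
    if "t \<in> {snd (pos x)..snd (pos (last (z # zs)))}" for t
  proof (cases "t \<le> ?y")
    case True
    then show ?thesis using g(4)[of t] that by (simp add: h_def)
  next
    case False
    then show ?thesis using f(3)[of t] that by (auto simp: h_def)
  qed
  ultimately show ?case unfolding curve_along_def by (intro exI[of _ h]) simp
qed

text \<open>
  A common point of the two curves lies on a segment of each chain.  These segments belong to
  different covering pairs, so by planarity the point is an end of both; being the position of one
  vertex only, it exhibits a vertex that the chains share.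
\<close>
lemma curves_meet_at_common_vertex:
  assumes planar: "planar_hasse_diagram A le pos"
    and covs: "\<And>a b. (a, b) \<in> chain_edges xs \<union> chain_edges ys \<Longrightarrow> covered_by A le a b"
    and disjoint: "chain_edges xs \<inter> chain_edges ys = {}"
    and curves: "curve_along pos xs f" "curve_along pos ys g"
    and t: "t \<in> {snd (pos (hd xs))..snd (pos (last xs))}" "t \<in> {snd (pos (hd ys))..snd (pos (last ys))}"
    and meet: "f t = g t"
  shows "\<exists>v\<in>set xs \<inter> set ys. t = snd (pos v)"
proof -
  obtain a b where ab: "(a, b) \<in> chain_edges xs" "(f t, t) \<in> closed_segment (pos a) (pos b)"
    using curves(1) t(1) unfolding curve_along_def by blast
  obtain c d where cd: "(c, d) \<in> chain_edges ys" "(f t, t) \<in> closed_segment (pos c) (pos d)"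
    using curves(2) t(2) unfolding curve_along_def meet by blast
  have cov: "covered_by A le a b" "covered_by A le c d" using ab cd covs by blast+
  have "(a, b) \<noteq> (c, d)" using ab cd disjoint by blast
  then have "(f t, t) \<in> {pos a, pos b} \<inter> {pos c, pos d}"
    using planar cov ab cd unfolding planar_hasse_diagram_def by blast
  then obtain v w where vw: "v \<in> {a, b}" "w \<in> {c, d}" "(f t, t) = pos v" "(f t, t) = pos w"
    by blast
  have "v \<in> A" "w \<in> A" using vw cov unfolding covered_by_def by auto
  moreover have "inj_on pos A"
    using planar unfolding planar_hasse_diagram_def hasse_diagram_def by blast
  ultimately have "v = w" using vw by (metis inj_onD)
  moreover have "{a, b} \<subseteq> set xs" "{c, d} \<subseteq> set ys"
    using ab(1) cd(1) by (auto dest: set_zip_leftD set_zip_rightD intro: list.set_sel(2))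
  ultimately show ?thesis using vw by (metis IntI snd_conv subsetD)
qed

lemma same_side:
  fixes f g :: "real \<Rightarrow> real"
  assumes cont: "continuous_on UNIV f" "continuous_on UNIV g" and "a \<le> b"
    and ne: "\<And>t. t \<in> {a..b} \<Longrightarrow> f t \<noteq> g t"
  shows "f a < g a \<longleftrightarrow> f b < g b"
proof -
  let ?d = "\<lambda>t. f t - g t"
  have c: "continuous_on {a..b} ?d"
    using continuous_on_diff[OF cont] by (rule continuous_on_subset) simp
  have nz: "\<not> (\<exists>t\<ge>a. t \<le> b \<and> ?d t = 0)" using ne by auto
  have "\<not> (?d a \<le> 0 \<and> 0 \<le> ?d b)"
    using IVT'[of ?d a 0 b] c nz \<open>a \<le> b\<close> by blast
  moreover have "\<not> (?d b \<le> 0 \<and> 0 \<le> ?d a)"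
    using IVT2'[of ?d b 0 a] c nz \<open>a \<le> b\<close> by blast
  ultimately show ?thesis by linarith
qed

text \<open>
  Here \<open>s\<close> is the spine, and the ears \<open>f\<close>, \<open>g\<close>, \<open>k\<close> touch it from \<open>h1\<close> to \<open>h4\<close>, from \<open>h2\<close>
  upwards, and up to \<open>h3\<close>, respectively.  The ear \<open>g\<close> cannot lie on the same side as \<open>f\<close>: at
  \<open>h2\<close> the ear \<open>g\<close> is on the spine and \<open>f\<close> is off it, while at \<open>h4\<close> it is the other way round, so
  that \<open>f\<close> and \<open>g\<close> would change their order.  Likewise \<open>k\<close> is not on the side of \<open>f\<close>, by the heights \<open>h1\<close> and \<open>h3\<close>, and
  not on the side of \<open>g\<close>, by the heights \<open>h2\<close> and \<open>h3\<close>.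
\<close>
lemma three_ears_cross:
  fixes s f g k :: "real \<Rightarrow> real"
  assumes cont: "continuous_on UNIV s" "continuous_on UNIV f" "continuous_on UNIV g" "continuous_on UNIV k"
    and order: "h1 < h2" "h2 < h3" "h3 < h4"
    and feet: "f h1 = s h1" "f h4 = s h4" "g h2 = s h2" "k h3 = s h3"
    and sf: "\<And>t. t \<in> {h2..h3} \<Longrightarrow> s t \<noteq> f t"
    and sg: "\<And>t. t \<in> {h3..h4} \<Longrightarrow> s t \<noteq> g t"
    and sk: "\<And>t. t \<in> {h1..h2} \<Longrightarrow> s t \<noteq> k t"
    and fg: "\<And>t. t \<in> {h2..h4} \<Longrightarrow> f t \<noteq> g t"
    and fk: "\<And>t. t \<in> {h1..h3} \<Longrightarrow> f t \<noteq> k t"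
    and gk: "\<And>t. t \<in> {h2..h3} \<Longrightarrow> g t \<noteq> k t"
  shows False
proof -
  \<comment> \<open>The ears are pairwise on different sides; the values at the ends are those of the spine.\<close>
  have "f h2 < s h2 \<longleftrightarrow> f h4 < g h4"
    using same_side[OF cont(2,3), of h2 h4] fg order feet by simp
  moreover have "f h1 < k h1 \<longleftrightarrow> f h3 < s h3"
    using same_side[OF cont(2,4), of h1 h3] fk order feet by simp
  moreover have "s h2 < k h2 \<longleftrightarrow> g h3 < s h3"
    using same_side[OF cont(3,4), of h2 h3] gk order feet by simp
  \<comment> \<open>Each ear keeps its side of the spine.\<close>
  moreover have "s h2 < f h2 \<longleftrightarrow> s h3 < f h3"
    using same_side[OF cont(1,2), of h2 h3] sf order by simp
  moreover have "s h3 < g h3 \<longleftrightarrow> s h4 < g h4"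
    using same_side[OF cont(1,3), of h3 h4] sg order by simp
  moreover have "s h1 < k h1 \<longleftrightarrow> s h2 < k h2"
    using same_side[OF cont(1,4), of h1 h2] sk order by simp
  moreover have "s h2 \<noteq> f h2" "s h3 \<noteq> f h3" "s h3 \<noteq> g h3" using sf sg order by auto
  ultimately show False using feet by (smt (verit))
qed

section \<open>A chain with three overlapping ears\<close>

definition ear_lo :: "nat \<Rightarrow> nat" where
  "ear_lo v = (if v = 5 then 1 else if v = 6 then 2 else if v = 7 then 0 else v)"

definition ear_hi :: "nat \<Rightarrow> nat" where
  "ear_hi v = (if v = 5 then 4 else if v = 6 then 8 else if v = 7 then 3 else v)"

abbreviation ear_join :: "nat \<Rightarrow> nat \<Rightarrow> nat" where
  "ear_join \<equiv> interval_join ear_lo ear_hi"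

interpretation ears: interval_labels ear_lo ear_hi
  by standard (auto simp: ear_lo_def ear_hi_def split: if_splits)

lemma ear_semilattice:
  assumes "9 \<le> n"
  shows "join_semilattice_on {..<n} ear_join"
  by (rule ears.semilattice) (use assms in \<open>auto simp: ear_hi_def lessThan_empty_iff\<close>)

lemma ear_cover:
  assumes "9 \<le> n"
    and "(x, y) \<in> {(0,1), (1,2), (2,3), (3,4), (4,8), (1,5), (5,4), (2,6), (6,8), (0,7), (7,3)}"
  shows "covered_by {..<n} (join_le ear_join) x y"
  using assms unfolding covered_by_def ears.join_le_iff
  by (auto simp: ear_lo_def ear_hi_def split: if_splits)

lemma ears_not_planar:
  assumes "9 \<le> n"
  shows "\<not> planar_semilattice {..<n} ear_join"
proof
  assume "planar_semilattice {..<n} ear_join"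
  then obtain pos where planar: "planar_hasse_diagram {..<n} (join_le ear_join) pos"
    unfolding planar_semilattice_def planar_poset_def by blast
  let ?cov = "covered_by {..<n} (join_le ear_join)"
  let ?h = "\<lambda>v. snd (pos v)"
  let ?S = "[0, 1, 2, 3, 4, 8]" and ?F = "[1, 5, 4]" and ?G = "[2, 6, 8]" and ?K = "[0, 7, 3]"
  note cover = ear_cover[OF assms]
  have up: "?h x < ?h y" if "?cov x y" for x y
    using that planar unfolding planar_hasse_diagram_def hasse_diagram_def by blast
  have h: "?h 0 < ?h 1" "?h 1 < ?h 2" "?h 2 < ?h 3" "?h 3 < ?h 4" "?h 4 < ?h 8"
    by (intro up cover; simp)+
  have ch: "?cov a b" if "(a, b) \<in> chain_edges ?S \<union> chain_edges ?F \<union> chain_edges ?G \<union> chain_edges ?K" for a b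
    using that by (intro cover) auto
  obtain s f g k where curves:
    "curve_along pos ?S s" "curve_along pos ?F f" "curve_along pos ?G g" "curve_along pos ?K k"
  proof -
    have "\<exists>s. curve_along pos ?S s" "\<exists>f. curve_along pos ?F f" "\<exists>g. curve_along pos ?G g"
      "\<exists>k. curve_along pos ?K k"
      by (rule ex_curve_along, rule up, rule ch, force)+
    then show thesis using that by blast
  qed
  have apart: "p t \<noteq> q t"
    if "curve_along pos xs p" "curve_along pos ys q" "{xs, ys} \<subseteq> {?S, ?F, ?G, ?K}"
      and "chain_edges xs \<inter> chain_edges ys = {}"
      and "t \<in> {?h (hd xs)..?h (last xs)}" "t \<in> {?h (hd ys)..?h (last ys)}"
      and "\<forall>v\<in>set xs \<inter> set ys. t \<noteq> ?h v" for xs ys p q t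
  proof
    assume "p t = q t"
    moreover have "?cov a b" if "(a, b) \<in> chain_edges xs \<union> chain_edges ys" for a b
      by (rule ch) (use that \<open>{xs, ys} \<subseteq> _\<close> in blast)
    ultimately show False
      using curves_meet_at_common_vertex[OF planar] that by blast
  qed
  show False
  proof (rule three_ears_cross[of s f g k "?h 1" "?h 2" "?h 3" "?h 4"])
    show "s t \<noteq> f t" if "t \<in> {?h 2..?h 3}" for t
      by (rule apart[OF curves(1,2)]; use that h in simp)
    show "s t \<noteq> g t" if "t \<in> {?h 3..?h 4}" for t
      by (rule apart[OF curves(1,3)]; use that h in simp)
    show "s t \<noteq> k t" if "t \<in> {?h 1..?h 2}" for t
      by (rule apart[OF curves(1,4)]; use that h in simp)
    show "f t \<noteq> g t" if "t \<in> {?h 2..?h 4}" for t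
      by (rule apart[OF curves(2,3)]; use that h in simp)
    show "f t \<noteq> k t" if "t \<in> {?h 1..?h 3}" for t
      by (rule apart[OF curves(2,4)]; use that h in simp)
    show "g t \<noteq> k t" if "t \<in> {?h 2..?h 3}" for t
      by (rule apart[OF curves(3,4)]; use that h in simp)
  qed (use curves h in \<open>auto simp: curve_along_def\<close>)
qed

section \<open>Counting the subsemilattices\<close>

text \<open>
  Each implication collects, for one ear, the incomparable elements whose join with this ear is its own upper
  end.  The join of the ears 5 and 7 is the upper end of 5, and a join with 6 is 8 unless the two
  elements are comparable, so the pairs of ears are covered by the first two lines.
\<close>
definition ear_closed :: "nat set \<Rightarrow> bool" where
  "ear_closed S \<longleftrightarrow>
     (5 \<in> S \<and> (2 \<in> S \<or> 3 \<in> S \<or> 7 \<in> S) \<longrightarrow> 4 \<in> S) \<and>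
     (6 \<in> S \<and> (3 \<in> S \<or> 4 \<in> S \<or> 5 \<in> S \<or> 7 \<in> S) \<longrightarrow> 8 \<in> S) \<and>
     (7 \<in> S \<and> (1 \<in> S \<or> 2 \<in> S) \<longrightarrow> 3 \<in> S)"

lemma closed_iff_ear_closed:
  "(\<forall>x\<in>S. \<forall>y\<in>S. ear_join x y \<in> S) \<longleftrightarrow> ear_closed S"
proof
  assume c: "\<forall>x\<in>S. \<forall>y\<in>S. ear_join x y \<in> S"
  have "ear_join 5 2 = 4" "ear_join 5 3 = 4" "ear_join 5 7 = 4" "ear_join 6 3 = 8" "ear_join 6 4 = 8"
    "ear_join 6 5 = 8" "ear_join 6 7 = 8" "ear_join 7 1 = 3" "ear_join 7 2 = 3"
    by (simp_all add: interval_join_def ear_lo_def ear_hi_def)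
  then show "ear_closed S" unfolding ear_closed_def using c by metis
next
  assume c: "ear_closed S"
  show "\<forall>x\<in>S. \<forall>y\<in>S. ear_join x y \<in> S"
  proof (intro ballI)
    have ear: "ear_join e y \<in> S" if "e \<in> {5, 6, 7}" "e \<in> S" "y \<in> S" for e y
    proof -
      have "8 \<le> y \<or> y \<in> {0, 1, 2, 3, 4, 5, 6, 7}" by auto
      then show ?thesis
        using c that unfolding ear_closed_def interval_join_def ear_lo_def ear_hi_def
        by (elim disjE insertE emptyE) simp_all
    qed
    fix x y assume xy: "x \<in> S" "y \<in> S"
    consider "x \<in> {5, 6, 7}" | "y \<in> {5, 6, 7}" | "x \<notin> {5, 6, 7}" "y \<notin> {5, 6, 7}" by blast
    then show "ear_join x y \<in> S"
    proof cases
      case 1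
      then show ?thesis using ear xy by blast
    next
      case 2
      then show ?thesis using ear[of y x] xy by (simp only: ears.join_commute)
    next
      case 3
      then have "ear_join x y = max x y"
        by (simp add: interval_join_def ear_lo_def ear_hi_def max_def)
      then show ?thesis using xy by (simp add: max_def)
    qed
  qed
qed

text \<open>
  Used as a rewrite rule, this splits a count of subsets by the membership of one element after
  the other; the predicate simplifies on the way.
\<close>
lemma card_filter_subsets_insert:
  assumes "finite A" "a \<notin> A"
  shows "card {S. S \<subseteq> insert a A \<and> P S} = card {S. S \<subseteq> A \<and> P S} + card {S. S \<subseteq> A \<and> P (insert a S)}"
proof -
  have "{S. S \<subseteq> insert a A \<and> P S} = {S. S \<subseteq> A \<and> P S} \<union> insert a ` {S. S \<subseteq> A \<and> P (insert a S)}"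
    (is "?l = ?r")
  proof (intro equalityI subsetI)
    fix S assume S: "S \<in> ?l"
    show "S \<in> ?r"
    proof (cases "a \<in> S")
      case True
      then have "insert a (S - {a}) = S" by blast
      then have "S - {a} \<in> {S. S \<subseteq> A \<and> P (insert a S)}" using S by auto
      then show ?thesis using \<open>insert a (S - {a}) = S\<close> by (metis UnI2 imageI)
    qed (use S in auto)
  qed auto
  moreover have "{S. S \<subseteq> A \<and> P S} \<inter> insert a ` {S. S \<subseteq> A \<and> P (insert a S)} = {}"
    using assms by auto
  moreover have "inj_on (insert a) {S. S \<subseteq> A \<and> P (insert a S)}"
    using assms by (intro inj_onI) (metis (no_types, lifting) insert_ident mem_Collect_eq subsetD)
  ultimately show ?thesis
    using assms by (simp add: card_Un_disjoint card_image)
qed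

lemma card_filter_subsets_empty: "card {S. S = {} \<and> P S} = of_bool (P {})"
proof -
  have "{S. S = {} \<and> P S} = (if P {} then {{}} else {})" by auto
  then show ?thesis by simp
qed

lemma card_ear_closed_base: "card {S. S \<subseteq> {..<9} \<and> ear_closed S} = 254"
proof -
  have nine: "{..<9} = {8, 7, 6, 5, 4, 3, 2, 1, 0::nat}" by auto
  show ?thesis
    unfolding nine ear_closed_def
    by (simp add: card_filter_subsets_insert card_filter_subsets_empty
        Pow_def[symmetric] card_Pow)
qed

text \<open>
  An element from 9 onwards is comparable to everything, hence is free to belong to a closed set
  or not.
\<close>
lemma card_ear_closed:
  assumes "9 \<le> n"
  shows "card {S. S \<subseteq> {..<n} \<and> ear_closed S} = 127 * 2 ^ (n - 8)"
  using assms
proof (induction n rule: nat_induct_at_least)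
  case base
  show ?case by (simp add: card_ear_closed_base)
next
  case (Suc n)
  have "ear_closed (insert n S) = ear_closed S" for S
    using Suc.hyps by (simp add: ear_closed_def)
  then show ?case
    using Suc by (simp add: lessThan_Suc card_filter_subsets_insert Suc_diff_le flip: power_Suc)
qed

theorem mainTheorem2:
  fixes n :: nat
  assumes "n \<ge> 9"
  shows "\<exists>(L :: nat set) (join :: nat \<Rightarrow> nat \<Rightarrow> nat).
           join_semilattice_on L join \<and> finite L \<and> card L = n \<and>
           \<not> planar_semilattice L join \<and>
           card (subsemilattices L join) = 127 * 2 ^ (n - 8) - 1"
proof -
  have "subsemilattices {..<n} ear_join = {S. S \<subseteq> {..<n} \<and> ear_closed S} - {{}}"
    unfolding subsemilattices_def closed_iff_ear_closed by auto
  moreover have "{} \<in> {S. S \<subseteq> {..<n} \<and> ear_closed S}"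
    by (simp add: ear_closed_def)
  ultimately have "card (subsemilattices {..<n} ear_join) = 127 * 2 ^ (n - 8) - 1"
    using card_ear_closed[OF assms] by (simp only: card_Diff_singleton)
  then show ?thesis
    using ear_semilattice[OF assms] ears_not_planar[OF assms]
    by (intro exI[of _ "{..<n}"] exI[of _ ear_join]) simp
qed

end
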